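(* Let $(\Sigma,\sigma)$ be a mixing shift of finite type with $K\times K$ adjacency matrix $A$, and let $R_A$ be the subring of $K_0(C(H,\alpha))$ generated by $[A,0]$ and $[A,1]$. Let the minimal polynomial of $A$ be $m_A(x)=x^l(x^k+a_{k-1}x^{k-1}+\cdots+a_0)$ with $a_0\ne0$. Then $$R_A\cong\mathbb Z[x,x^{-1}]/\langle p_A(x)\rangle$$ as rings, where $p_A(x)=x^k+a_{k-1}x^{k-1}+\cdots+a_0$.
   Context: $A$ is a primitive $K\times K$ matrix with non-negative integer entries and $(\Sigma,\sigma)$ the associated edge shift. $H=H(\Sigma,\sigma)$ is the groupoid $C^*$-algebra of the homoclinic relation ($x_n=y_n$ for all but finitely many $n$), $\alpha(f)(x,y)=f(\sigma^{-1}x,\sigma^{-1}y)$, and $C(H,\alpha)=\{f:\mathbb R\to H\text{ continuous}:f(t+1)=\alpha(f(t))\}$; the ring structure on $K_0(C(H,\alpha))$ is induced by the asymptotic morphism $f\otimes g\mapsto\alpha_t(f)\alpha_{-t}(g)$, $t\to+\infty$, where $\alpha_t(f)(s)=f(s+t)$. Explicitly, with $C(A)=\{X\in M_K(\mathbb Z):AX=XA\}$, the ring $K_0(C(H,\alpha))$ is the inductive limit of $C(A)\to C(A)\to\cdots$ with all maps $X\mapsto AXA$; $[X,N]$ is the class of $X$ in the $N$th group ($N\ge0$), so $[X,N]=[AXA,N+1]$; and the product is $[X,N]\ast[Y,M]=[XY,N+M]$. The unit is $[I,0]$, and $[A,0]$ and $[A,1]$ are inverse to each other. *)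

theory Defs
  imports
    "HOL-Library.Poly_Mapping"
    "HOL-Algebra.Generated_Rings"
    "HOL-Algebra.QuotRing"
    "Jordan_Normal_Form.VS_Connect"
    "Jordan_Normal_Form.Matrix"
begin

definition primitive_mat :: "int mat \<Rightarrow> bool" where
  "primitive_mat A \<longleftrightarrow> square_mat A \<and> 0 < dim_row A \<and>
     (\<forall>i<dim_row A. \<forall>j<dim_row A. 0 \<le> A $$ (i, j)) \<and>
     (\<exists>m>0. \<forall>i<dim_row A. \<forall>j<dim_row A. 0 < (A ^\<^sub>m m) $$ (i, j))"

text \<open>\<open>p(A)\<close>, where the constant term of \<open>p\<close> multiplies the identity matrix.\<close>

definition mat_poly :: "'a::comm_ring_1 Polynomial.poly \<Rightarrow> 'a mat \<Rightarrow> 'a mat" where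
  "mat_poly p A = mat (dim_row A) (dim_row A)
     (\<lambda>(i, j). \<Sum>d\<le>Polynomial.degree p. Polynomial.coeff p d * (A ^\<^sub>m d) $$ (i, j))"

definition is_minimal_poly :: "'a::field mat \<Rightarrow> 'a Polynomial.poly \<Rightarrow> bool" where
  "is_minimal_poly A m \<longleftrightarrow>
     Polynomial.lead_coeff m = 1 \<and> mat_poly m A = 0\<^sub>m (dim_row A) (dim_row A) \<and>
     (\<forall>q. q \<noteq> 0 \<and> mat_poly q A = 0\<^sub>m (dim_row A) (dim_row A)
        \<longrightarrow> Polynomial.degree m \<le> Polynomial.degree q)"

text \<open>
  The ring \<open>K\<^sub>0(C(H, \<alpha>))\<close> of the edge shift of \<open>A\<close>, in its concrete form as the inductive limit
  of \<open>C(A) \<rightarrow> C(A) \<rightarrow> \<dots>\<close> with connecting maps \<open>U \<mapsto> A U A\<close>: the pairs \<open>(U, N)\<close> and \<open>(V, M)\<close>, with \<open>U\<close>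
  in the \<open>N\<close>th and \<open>V\<close> in the \<open>M\<close>th group, are identified iff they have the same image in some
  later group.
\<close>

definition commutant :: "int mat \<Rightarrow> int mat set" where
  "commutant A = {U \<in> carrier_mat (dim_row A) (dim_row A). A * U = U * A}"

definition conn :: "int mat \<Rightarrow> int mat \<Rightarrow> int mat" where
  "conn A U = A * U * A"

definition lim_rel :: "int mat \<Rightarrow> ((int mat \<times> nat) \<times> (int mat \<times> nat)) set" where
  "lim_rel A = {((U, N), (V, M)). U \<in> commutant A \<and> V \<in> commutant A \<and>
     (\<exists>i j. N + i = M + j \<and> (conn A ^^ i) U = (conn A ^^ j) V)}"

definition lim_class :: "int mat \<Rightarrow> int mat \<Rightarrow> nat \<Rightarrow> (int mat \<times> nat) set" where
  "lim_class A U N = lim_rel A `` {(U, N)}"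

text \<open>
  The operations are given on representatives; the unions are over singletons up to equality (see
  \<open>K0_ring_mult\<close> and \<open>K0_ring_add\<close> below).  For the sum both representatives are first
  moved to the group with index \<open>N + M\<close>.
\<close>

definition K0_ring :: "int mat \<Rightarrow> (int mat \<times> nat) set ring" where
  "K0_ring A = \<lparr>
     carrier = (commutant A \<times> UNIV) // lim_rel A,
     mult = (\<lambda>P Q. \<Union>(U, N)\<in>P. \<Union>(V, M)\<in>Q. lim_class A (U * V) (N + M)),
     one = lim_class A (1\<^sub>m (dim_row A)) 0,
     zero = lim_class A (0\<^sub>m (dim_row A) (dim_row A)) 0,
     add = (\<lambda>P Q. \<Union>(U, N)\<in>P. \<Union>(V, M)\<in>Q.
              lim_class A ((conn A ^^ M) U + (conn A ^^ N) V) (N + M))\<rparr>"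

definition R_ring :: "int mat \<Rightarrow> (int mat \<times> nat) set ring" where
  "R_ring A = (K0_ring A)\<lparr>carrier := generate_ring (K0_ring A) {lim_class A A 0, lim_class A A 1}\<rparr>"

text \<open>
  \<open>\<int>[x, x\<^sup>-\<^sup>1]\<close> as the group ring of \<open>\<int>\<close>: finitely supported coefficient functions
  \<open>int \<Rightarrow> int\<close> under convolution, \<open>Poly_Mapping.single n c\<close> being \<open>c x\<^sup>n\<close>.
\<close>

abbreviation laurent_ring :: "(int \<Rightarrow>\<^sub>0 int) ring" where
  "laurent_ring \<equiv> class_ring"

section \<open>Well-definedness of the inductive limit ring\<close>

lemma UN_UN_const:
  assumes "p \<in> P" "q \<in> Q"
    and "\<And>a b c d. (a, b) \<in> P \<Longrightarrow> (c, d) \<in> Q \<Longrightarrow> f a b c d = C"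
  shows "(\<Union>(a, b)\<in>P. \<Union>(c, d)\<in>Q. f a b c d) = C"
proof -
  have inner: "(\<Union>(c, d)\<in>Q. f a b c d) = C" if "(a, b) \<in> P" for a b
    using assms(2) assms(3)[OF that] by (intro SUP_eq_const) auto
  show ?thesis
  proof (rule SUP_eq_const)
    show "P \<noteq> {}" using assms(1) by blast
    show "(case x of (a, b) \<Rightarrow> \<Union>(c, d)\<in>Q. f a b c d) = C" if "x \<in> P" for x
      using that inner by (cases x) (simp only: case_prod_conv)
  qed
qed

context
  fixes A :: "int mat" and n :: nat
  assumes A: "A \<in> carrier_mat n n"
begin

lemma commutant_iff: "U \<in> commutant A \<longleftrightarrow> U \<in> carrier_mat n n \<and> A * U = U * A"
  using A by (auto simp: commutant_def)

lemma commutant_mult: 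
  assumes "U \<in> commutant A" "V \<in> commutant A" shows "U * V \<in> commutant A"
proof -
  have U: "U \<in> carrier_mat n n" "A * U = U * A" and V: "V \<in> carrier_mat n n" "A * V = V * A"
    using assms by (auto simp: commutant_iff)
  have "A * (U * V) = (A * U) * V" using A U(1) V(1) by (simp add: assoc_mult_mat[of _ n n _ n _ n])
  also have "\<dots> = U * (A * V)"
    unfolding U(2) using A U(1) V(1) by (simp add: assoc_mult_mat[of _ n n _ n _ n])
  also have "\<dots> = (U * V) * A"
    unfolding V(2) using A U(1) V(1) by (simp add: assoc_mult_mat[of _ n n _ n _ n])
  finally show ?thesis using U V by (simp add: commutant_iff)
qed

lemma commutant_add: "U \<in> commutant A \<Longrightarrow> V \<in> commutant A \<Longrightarrow> U + V \<in> commutant A"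
  using A by (auto simp: commutant_iff mult_add_distrib_mat[of _ n n _ n] add_mult_distrib_mat[of _ n n _ _ n])

lemma commutant_self: "A \<in> commutant A"
  and commutant_one: "1\<^sub>m n \<in> commutant A"
  and commutant_zero: "0\<^sub>m n n \<in> commutant A"
  using A by (auto simp: commutant_iff)

lemma commutant_uminus: "U \<in> commutant A \<Longrightarrow> - U \<in> commutant A"
  using A by (auto simp: commutant_iff)

lemma conn_commutant: "U \<in> commutant A \<Longrightarrow> conn A U \<in> commutant A"
  by (simp add: conn_def commutant_mult commutant_self)

lemma funpow_conn_commutant: "U \<in> commutant A \<Longrightarrow> (conn A ^^ i) U \<in> commutant A"
  by (induction i) (auto simp: conn_commutant)

lemma conn_add: "U \<in> commutant A \<Longrightarrow> V \<in> commutant A \<Longrightarrow> conn A (U + V) = conn A U + conn A V"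
  using A by (auto simp: commutant_iff conn_def mult_add_distrib_mat[of _ n n _ n] add_mult_distrib_mat[of _ n n _ _ n])

lemma funpow_conn_add:
  "U \<in> commutant A \<Longrightarrow> V \<in> commutant A \<Longrightarrow> (conn A ^^ i) (U + V) = (conn A ^^ i) U + (conn A ^^ i) V"
  by (induction i) (auto simp: conn_add funpow_conn_commutant)

lemma conn_mult_left:
  assumes "U \<in> commutant A" "V \<in> commutant A" shows "conn A (U * V) = conn A U * V"
proof -
  have U: "U \<in> carrier_mat n n" "A * U = U * A" and V: "V \<in> carrier_mat n n" "A * V = V * A"
    using assms by (auto simp: commutant_iff)
  have "conn A (U * V) = A * U * (V * A)"
    using A U(1) V(1) by (simp add: conn_def assoc_mult_mat[of _ n n _ n _ n])
  also have "\<dots> = conn A U * V"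
    using A U(1) V by (simp add: conn_def assoc_mult_mat[of _ n n _ n _ n] flip: V(2))
  finally show ?thesis .
qed

lemma conn_mult_right:
  assumes "U \<in> commutant A" "V \<in> commutant A" shows "conn A (U * V) = U * conn A V"
proof -
  have U: "U \<in> carrier_mat n n" "A * U = U * A" and V: "V \<in> carrier_mat n n" "A * V = V * A"
    using assms by (auto simp: commutant_iff)
  have "conn A (U * V) = (A * U) * (V * A)"
    using A U(1) V(1) by (simp add: conn_def assoc_mult_mat[of _ n n _ n _ n])
  also have "\<dots> = U * conn A V"
    unfolding U(2) using A U(1) V(1) by (simp add: conn_def assoc_mult_mat[of _ n n _ n _ n])
  finally show ?thesis .
qed

lemma funpow_conn_mult:
  assumes "U \<in> commutant A" "V \<in> commutant A"
  shows "(conn A ^^ (i + j)) (U * V) = (conn A ^^ i) U * (conn A ^^ j) V"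
proof -
  have 1: "(conn A ^^ i) (U * V) = (conn A ^^ i) U * V" if "U \<in> commutant A" "V \<in> commutant A" for U V i
    using that by (induction i) (auto simp: conn_mult_left funpow_conn_commutant)
  have 2: "(conn A ^^ i) (U * V) = U * (conn A ^^ i) V" if "U \<in> commutant A" "V \<in> commutant A" for U V i
    using that by (induction i) (auto simp: conn_mult_right funpow_conn_commutant)
  have "(conn A ^^ (i + j)) (U * V) = (conn A ^^ i) (U * (conn A ^^ j) V)"
    using assms by (simp add: funpow_add 2)
  also have "\<dots> = (conn A ^^ i) U * (conn A ^^ j) V"
    using assms by (intro 1) (auto simp: funpow_conn_commutant)
  finally show ?thesis .
qed

lemma lim_relI:
  assumes "U \<in> commutant A" "V \<in> commutant A" "N + i = M + j" "(conn A ^^ i) U = (conn A ^^ j) V"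
  shows "((U, N), (V, M)) \<in> lim_rel A"
  using assms unfolding lim_rel_def by blast

lemma equiv_lim_rel: "equiv (commutant A \<times> UNIV) (lim_rel A)"
proof (rule equivI)
  show "lim_rel A \<subseteq> (commutant A \<times> UNIV) \<times> (commutant A \<times> UNIV)" by (auto simp: lim_rel_def)
  show "refl_on (commutant A \<times> UNIV) (lim_rel A)"
    by (auto simp: refl_on_def intro: lim_relI[of _ _ _ 0 _ 0])
  show "sym (lim_rel A)" unfolding sym_def lim_rel_def by clarsimp metis
  show "trans (lim_rel A)"
  proof (rule transI, clarify)
    fix U N V M W L
    assume "((U, N), (V, M)) \<in> lim_rel A" "((V, M), (W, L)) \<in> lim_rel A"
    then obtain i j i' j' where *: "U \<in> commutant A" "V \<in> commutant A" "W \<in> commutant A"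
      "N + i = M + j" "(conn A ^^ i) U = (conn A ^^ j) V"
      "M + i' = L + j'" "(conn A ^^ i') V = (conn A ^^ j') W"
      unfolding lim_rel_def by auto
    have "(conn A ^^ (i' + i)) U = (conn A ^^ (i' + j)) V" using *(5) by (simp add: funpow_add)
    also have "\<dots> = (conn A ^^ (j + i')) V" by (simp add: add.commute)
    also have "\<dots> = (conn A ^^ (j + j')) W" using *(7) by (simp add: funpow_add)
    finally show "((U, N), (W, L)) \<in> lim_rel A"
      using * by (intro lim_relI[of _ _ _ "i' + i" _ "j + j'"]) auto
  qed
qed

lemma lim_class_eq_iff:
  "U \<in> commutant A \<Longrightarrow> V \<in> commutant A \<Longrightarrow> lim_class A U N = lim_class A V M \<longleftrightarrow>
     (\<exists>i j. N + i = M + j \<and> (conn A ^^ i) U = (conn A ^^ j) V)"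
  unfolding lim_class_def by (subst eq_equiv_class_iff[OF equiv_lim_rel]) (auto simp: lim_rel_def)

lemma lim_class_conn: "U \<in> commutant A \<Longrightarrow> lim_class A U N = lim_class A (A * U * A) (Suc N)"
  by (subst lim_class_eq_iff)
     (auto simp: conn_commutant conn_def commutant_mult commutant_self intro!: exI[of _ 1] exI[of _ 0])

lemma lim_class_funpow:
  "U \<in> commutant A \<Longrightarrow> lim_class A ((conn A ^^ i) U) (N + i) = lim_class A U N"
  by (subst lim_class_eq_iff) (auto simp: funpow_conn_commutant intro!: exI[of _ 0])

lemma lim_class_eqI:
  assumes "U \<in> commutant A" "V \<in> commutant A" "N + i = M + j" "(conn A ^^ i) U = (conn A ^^ j) V"
  shows "lim_class A U N = lim_class A V M"
  using assms lim_class_eq_iff by blast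

lemma K0_ring_mult:
  assumes "U \<in> commutant A" "V \<in> commutant A"
  shows "lim_class A U N \<otimes>\<^bsub>K0_ring A\<^esub> lim_class A V M = lim_class A (U * V) (N + M)"
proof -
  have "lim_class A (U' * V') (N' + M') = lim_class A (U * V) (N + M)"
    if "((U, N), (U', N')) \<in> lim_rel A" "((V, M), (V', M')) \<in> lim_rel A" for U' N' V' M'
  proof -
    from that obtain i j i' j' where *: "U' \<in> commutant A" "V' \<in> commutant A"
      "N + i = N' + j" "(conn A ^^ i) U = (conn A ^^ j) U'"
      "M + i' = M' + j'" "(conn A ^^ i') V = (conn A ^^ j') V'"
      unfolding lim_rel_def by auto
    show ?thesis using * assms
      by (intro lim_class_eqI[of _ _ _ "j + j'" _ "i + i'"]) (auto simp: commutant_mult funpow_conn_mult)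
  qed
  moreover have "((U, N), (U, N)) \<in> lim_rel A" "((V, M), (V, M)) \<in> lim_rel A"
    using assms by (auto intro: lim_relI[of _ _ _ 0 _ 0])
  ultimately have "(\<Union>(U', N')\<in>lim_class A U N. \<Union>(V', M')\<in>lim_class A V M. lim_class A (U' * V') (N' + M')) = lim_class A (U * V) (N + M)"
    unfolding lim_class_def[of A U N] lim_class_def[of A V M]
    by (intro UN_UN_const[of "(U, N)" _ "(V, M)"]) (blast | simp only: Image_singleton_iff)+
  then show ?thesis by (simp add: K0_ring_def)
qed

lemma K0_ring_add:
  assumes "U \<in> commutant A" "V \<in> commutant A"
  shows "lim_class A U N \<oplus>\<^bsub>K0_ring A\<^esub> lim_class A V M =
           lim_class A ((conn A ^^ M) U + (conn A ^^ N) V) (N + M)"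
proof -
  have "lim_class A ((conn A ^^ M') U' + (conn A ^^ N') V') (N' + M') =
          lim_class A ((conn A ^^ M) U + (conn A ^^ N) V) (N + M)"
    if "((U, N), (U', N')) \<in> lim_rel A" "((V, M), (V', M')) \<in> lim_rel A" for U' N' V' M'
  proof -
    from that obtain i j i' j' where *: "U' \<in> commutant A" "V' \<in> commutant A"
      "N + i = N' + j" "(conn A ^^ i) U = (conn A ^^ j) U'"
      "M + i' = M' + j'" "(conn A ^^ i') V = (conn A ^^ j') V'"
      unfolding lim_rel_def by auto
    have U: "(conn A ^^ (j + j' + M')) U' = (conn A ^^ (i + i' + M)) U"
    proof -
      have "(conn A ^^ (j + j' + M')) U' = (conn A ^^ ((M' + j') + j)) U'" by (simp add: ac_simps)
      also have "\<dots> = (conn A ^^ ((M' + j') + i)) U" by (simp add: funpow_add *)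
      finally show ?thesis by (simp add: ac_simps flip: *(5))
    qed
    have V: "(conn A ^^ (j + j' + N')) V' = (conn A ^^ (i + i' + N)) V"
    proof -
      have "(conn A ^^ (j + j' + N')) V' = (conn A ^^ ((N' + j) + j')) V'" by (simp add: ac_simps)
      also have "\<dots> = (conn A ^^ ((N' + j) + i')) V" by (simp add: funpow_add *)
      finally show ?thesis by (simp add: ac_simps flip: *(3))
    qed
    have U': "(conn A ^^ (j + j')) ((conn A ^^ M') U') = (conn A ^^ (i + i')) ((conn A ^^ M) U)"
      using U by (simp add: funpow_add)
    have V': "(conn A ^^ (j + j')) ((conn A ^^ N') V') = (conn A ^^ (i + i')) ((conn A ^^ N) V)"
      using V by (simp add: funpow_add)
    show ?thesis
    proof (rule lim_class_eqI[of _ _ _ "j + j'" _ "i + i'"])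
      show "N' + M' + (j + j') = N + M + (i + i')" using *(3,5) by simp
      show "(conn A ^^ (j + j')) ((conn A ^^ M') U' + (conn A ^^ N') V') =
              (conn A ^^ (i + i')) ((conn A ^^ M) U + (conn A ^^ N) V)"
        unfolding funpow_conn_add[OF *(1,2)[THEN funpow_conn_commutant]]
          funpow_conn_add[OF assms[THEN funpow_conn_commutant]] U' V' ..
    qed (intro commutant_add funpow_conn_commutant *(1,2) assms)+
  qed
  moreover have "((U, N), (U, N)) \<in> lim_rel A" "((V, M), (V, M)) \<in> lim_rel A"
    using assms by (auto intro: lim_relI[of _ _ _ 0 _ 0])
  ultimately have "(\<Union>(U', N')\<in>lim_class A U N. \<Union>(V', M')\<in>lim_class A V M. 
          lim_class A ((conn A ^^ M') U' + (conn A ^^ N') V') (N' + M')) = 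
        lim_class A ((conn A ^^ M) U + (conn A ^^ N) V) (N + M)"
    unfolding lim_class_def[of A U N] lim_class_def[of A V M]
    by (intro UN_UN_const[of "(U, N)" _ "(V, M)"]) (blast | simp only: Image_singleton_iff)+
  then show ?thesis by (simp add: K0_ring_def)
qed

lemma K0_ring_add_same:
  assumes "U \<in> commutant A" "V \<in> commutant A"
  shows "lim_class A U N \<oplus>\<^bsub>K0_ring A\<^esub> lim_class A V N = lim_class A (U + V) N"
  using assms
  by (simp add: K0_ring_add lim_class_funpow commutant_add flip: funpow_conn_add)

lemma K0_carrierE:
  assumes "P \<in> carrier (K0_ring A)"
  obtains U N where "U \<in> commutant A" "P = lim_class A U N"
  using assms by (auto simp: K0_ring_def lim_class_def elim!: quotientE)

lemma lim_class_carrier: "U \<in> commutant A \<Longrightarrow> lim_class A U N \<in> carrier (K0_ring A)"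
  by (auto simp: K0_ring_def lim_class_def intro: quotientI)

lemma K0_common_level:
  assumes "P \<in> carrier (K0_ring A)" "Q \<in> carrier (K0_ring A)" "S \<in> carrier (K0_ring A)"
  obtains U V W N where "U \<in> commutant A" "V \<in> commutant A" "W \<in> commutant A"
    "P = lim_class A U N" "Q = lim_class A V N" "S = lim_class A W N"
proof -
  obtain U V W N M L where *: "U \<in> commutant A" "V \<in> commutant A" "W \<in> commutant A"
    "P = lim_class A U N" "Q = lim_class A V M" "S = lim_class A W L"
    using assms by (meson K0_carrierE)
  have "P = lim_class A ((conn A ^^ (M + L)) U) (N + M + L)"
    using lim_class_funpow[OF *(1), of "M + L" N] *(4) by (simp add: ac_simps)
  moreover have "Q = lim_class A ((conn A ^^ (N + L)) V) (N + M + L)"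
    using lim_class_funpow[OF *(2), of "N + L" M] *(5) by (simp add: ac_simps)
  moreover have "S = lim_class A ((conn A ^^ (N + M)) W) (N + M + L)"
    using lim_class_funpow[OF *(3), of "N + M" L] *(6) by (simp add: ac_simps)
  ultimately show ?thesis by (rule that[OF *(1-3)[THEN funpow_conn_commutant]])
qed

lemma K0_one: "\<one>\<^bsub>K0_ring A\<^esub> = lim_class A (1\<^sub>m n) 0"
  using A by (simp add: K0_ring_def)

lemma K0_zero: "\<zero>\<^bsub>K0_ring A\<^esub> = lim_class A (0\<^sub>m n n) N"
proof -
  have "(conn A ^^ N) (0\<^sub>m n n) = 0\<^sub>m n n" for N using A by (induction N) (auto simp: conn_def)
  then show ?thesis
    using A lim_class_funpow[OF commutant_zero, of N 0] by (simp add: K0_ring_def)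
qed

lemma ring_K0_ring: "ring (K0_ring A)"
proof (rule ringI)
  show "abelian_group (K0_ring A)"
  proof (rule abelian_groupI)
    fix P Q S assume c: "P \<in> carrier (K0_ring A)" "Q \<in> carrier (K0_ring A)" "S \<in> carrier (K0_ring A)"
    then obtain U V W N where *: "U \<in> commutant A" "V \<in> commutant A" "W \<in> commutant A"
      "P = lim_class A U N" "Q = lim_class A V N" "S = lim_class A W N"
      by (rule K0_common_level)
    have d: "U \<in> carrier_mat n n" "V \<in> carrier_mat n n" "W \<in> carrier_mat n n"
      using * by (auto simp: commutant_iff)
    show "P \<oplus>\<^bsub>K0_ring A\<^esub> Q \<oplus>\<^bsub>K0_ring A\<^esub> S = P \<oplus>\<^bsub>K0_ring A\<^esub> (Q \<oplus>\<^bsub>K0_ring A\<^esub> S)"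
      using * d by (simp add: K0_ring_add_same commutant_add assoc_add_mat[of _ n n])
  next
    fix P Q assume c: "P \<in> carrier (K0_ring A)" "Q \<in> carrier (K0_ring A)"
    obtain U V W N where *: "U \<in> commutant A" "V \<in> commutant A"
      "P = lim_class A U N" "Q = lim_class A V N"
      using K0_common_level[OF c c(2)] by metis
    have d: "U \<in> carrier_mat n n" "V \<in> carrier_mat n n"
      using * by (auto simp: commutant_iff)
    show "P \<oplus>\<^bsub>K0_ring A\<^esub> Q = Q \<oplus>\<^bsub>K0_ring A\<^esub> P"
      using * d by (simp add: K0_ring_add_same comm_add_mat[of _ n n])
    show "P \<oplus>\<^bsub>K0_ring A\<^esub> Q \<in> carrier (K0_ring A)"
      using * by (simp add: K0_ring_add_same commutant_add lim_class_carrier)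
  next
    show "\<zero>\<^bsub>K0_ring A\<^esub> \<in> carrier (K0_ring A)"
      by (simp add: K0_zero[of 0] lim_class_carrier commutant_zero)
  next
    fix P assume "P \<in> carrier (K0_ring A)"
    then obtain U N where *: "U \<in> commutant A" "P = lim_class A U N" by (rule K0_carrierE)
    have d: "U \<in> carrier_mat n n" using * by (auto simp: commutant_iff)
    show "\<zero>\<^bsub>K0_ring A\<^esub> \<oplus>\<^bsub>K0_ring A\<^esub> P = P"
      using * d by (simp add: K0_zero[of N] K0_ring_add_same commutant_zero)
    show "\<exists>Q\<in>carrier (K0_ring A). Q \<oplus>\<^bsub>K0_ring A\<^esub> P = \<zero>\<^bsub>K0_ring A\<^esub>"
      using * d
      by (intro bexI[of _ "lim_class A (- U) N"])
         (simp_all add: K0_zero[of N] K0_ring_add_same commutant_uminus lim_class_carrier uminus_l_inv_mat)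
  qed
  show "monoid (K0_ring A)"
  proof (rule monoidI)
    fix P Q S assume c: "P \<in> carrier (K0_ring A)" "Q \<in> carrier (K0_ring A)" "S \<in> carrier (K0_ring A)"
    then obtain U V W N where *: "U \<in> commutant A" "V \<in> commutant A" "W \<in> commutant A"
      "P = lim_class A U N" "Q = lim_class A V N" "S = lim_class A W N"
      by (rule K0_common_level)
    have d: "U \<in> carrier_mat n n" "V \<in> carrier_mat n n" "W \<in> carrier_mat n n"
      using * by (auto simp: commutant_iff)
    show "P \<otimes>\<^bsub>K0_ring A\<^esub> Q \<otimes>\<^bsub>K0_ring A\<^esub> S = P \<otimes>\<^bsub>K0_ring A\<^esub> (Q \<otimes>\<^bsub>K0_ring A\<^esub> S)"
      using * d by (simp add: K0_ring_mult commutant_mult assoc_mult_mat[of _ n n _ n _ n] ac_simps)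
  next
    fix P Q assume c: "P \<in> carrier (K0_ring A)" "Q \<in> carrier (K0_ring A)"
    obtain U V W N where *: "U \<in> commutant A" "V \<in> commutant A"
      "P = lim_class A U N" "Q = lim_class A V N"
      using K0_common_level[OF c c(2)] by metis
    show "P \<otimes>\<^bsub>K0_ring A\<^esub> Q \<in> carrier (K0_ring A)"
      using * by (simp add: K0_ring_mult commutant_mult lim_class_carrier)
  next
    show "\<one>\<^bsub>K0_ring A\<^esub> \<in> carrier (K0_ring A)"
      by (simp add: K0_one lim_class_carrier commutant_one)
  next
    fix P assume "P \<in> carrier (K0_ring A)"
    then obtain U N where *: "U \<in> commutant A" "P = lim_class A U N" by (rule K0_carrierE)
    have d: "U \<in> carrier_mat n n" using * by (auto simp: commutant_iff)
    show "\<one>\<^bsub>K0_ring A\<^esub> \<otimes>\<^bsub>K0_ring A\<^esub> P = P" "P \<otimes>\<^bsub>K0_ring A\<^esub> \<one>\<^bsub>K0_ring A\<^esub> = P"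
      using * d by (simp_all add: K0_one K0_ring_mult commutant_one)
  qed
  fix P Q S assume c: "P \<in> carrier (K0_ring A)" "Q \<in> carrier (K0_ring A)" "S \<in> carrier (K0_ring A)"
  then obtain U V W N where *: "U \<in> commutant A" "V \<in> commutant A" "W \<in> commutant A"
    "P = lim_class A U N" "Q = lim_class A V N" "S = lim_class A W N"
    by (rule K0_common_level)
  have d: "U \<in> carrier_mat n n" "V \<in> carrier_mat n n" "W \<in> carrier_mat n n"
    using * by (auto simp: commutant_iff)
  show "(P \<oplus>\<^bsub>K0_ring A\<^esub> Q) \<otimes>\<^bsub>K0_ring A\<^esub> S =
          P \<otimes>\<^bsub>K0_ring A\<^esub> S \<oplus>\<^bsub>K0_ring A\<^esub> Q \<otimes>\<^bsub>K0_ring A\<^esub> S"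
    using * d by (simp add: K0_ring_add_same K0_ring_mult commutant_add commutant_mult
        add_mult_distrib_mat[of _ n n _ _ n])
  show "S \<otimes>\<^bsub>K0_ring A\<^esub> (P \<oplus>\<^bsub>K0_ring A\<^esub> Q) =
          S \<otimes>\<^bsub>K0_ring A\<^esub> P \<oplus>\<^bsub>K0_ring A\<^esub> S \<otimes>\<^bsub>K0_ring A\<^esub> Q"
    using * d by (simp add: K0_ring_add_same K0_ring_mult commutant_add commutant_mult
        mult_add_distrib_mat[of _ n n _ n])
qed

lemma lim_class_A_inverse:
  "lim_class A A 0 \<otimes>\<^bsub>K0_ring A\<^esub> lim_class A A 1 = \<one>\<^bsub>K0_ring A\<^esub>"
  "lim_class A A 1 \<otimes>\<^bsub>K0_ring A\<^esub> lim_class A A 0 = \<one>\<^bsub>K0_ring A\<^esub>"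
  using A lim_class_conn[OF commutant_one, of 0] by (simp_all add: K0_ring_mult K0_one commutant_self)

end

end

theory Submission
  imports Defs "Jordan_Normal_Form.Char_Poly"
begin

text \<open>
  Evaluating Laurent polynomials at the unit \<open>u = [A, 0]\<close>, whose inverse is \<open>[A, 1]\<close>, is a ring
  homomorphism from \<open>\<int>[x, x\<^sup>-\<^sup>1]\<close> to the inductive limit, and its image is exactly \<open>R\<^sub>A\<close>.  By the
  first isomorphism theorem only its kernel has to be found.

  A Laurent polynomial has the form \<open>f = x\<^sup>-\<^sup>2\<^sup>N g\<close> with \<open>g \<in> \<int>[x]\<close>.  As \<open>[I, 1] = u\<^sup>-\<^sup>2\<close>, it evaluates
  to \<open>[g(A), N]\<close>.  This class vanishes iff some iterate of \<open>X \<mapsto> A X A\<close> kills \<open>g(A)\<close>, that is, iff \<open>x\<^sup>2\<^sup>i g\<close>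
  annihilates \<open>A\<close> for some \<open>i\<close>, that is, iff \<open>x\<^sup>l p\<close> divides \<open>x\<^sup>2\<^sup>i g\<close> for some \<open>i\<close>, where \<open>x\<^sup>l p\<close> is the
  minimal polynomial.  Since \<open>p(0) \<noteq> 0\<close>, powers of \<open>x\<close> can be cancelled against \<open>p\<close>, and since \<open>i\<close> is
  arbitrary, the factor \<open>x\<^sup>l\<close> imposes no condition.  So the kernel consists of the multiples of \<open>p\<close>
  (\<open>R_ring_iso_laurent_quotient\<close>).

  Divisibility has to be understood in \<open>\<int>[x]\<close>, while the minimal polynomial is given over \<open>\<rat>\<close>.  It has
  integer coefficients because it divides the characteristic polynomial (\<open>Cayley_Hamilton_mat\<close>),
  which is monic and integral, and by Gauss's lemma a monic rational factor of such a polynomial is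
  integral (\<open>monic_rat_factor_of_monic_int_poly\<close>).  Being monic, it also generates the ideal of all
  integer polynomials that annihilate \<open>A\<close> (\<open>integral_minimal_poly\<close>).
\<close>

section \<open>Polynomials evaluated at a square matrix\<close>

lemma mat_poly_carrier [simp]: "A \<in> carrier_mat n n \<Longrightarrow> mat_poly p A \<in> carrier_mat n n"
  by (auto simp: mat_poly_def)

lemma mat_poly_dim [simp]: "dim_row (mat_poly p A) = dim_row A" "dim_col (mat_poly p A) = dim_row A"
  by (auto simp: mat_poly_def)

lemma one_smult_mat [simp]: "(1 :: 'a :: monoid_mult) \<cdot>\<^sub>m M = M"
  by (rule eq_matI) auto

lemma zero_smult_mat: "M \<in> carrier_mat nr nc \<Longrightarrow> (0 :: 'a :: mult_zero) \<cdot>\<^sub>m M = 0\<^sub>m nr nc"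
  by (rule eq_matI) auto

text \<open>The range of summation in the definition depends on the polynomial.  With a common upper bound,
  the entries of polynomials of different degrees can be compared term by term.\<close>

lemma mat_poly_index:
  assumes "A \<in> carrier_mat n n" "Polynomial.degree p \<le> N" "i < n" "j < n"
  shows "mat_poly p A $$ (i, j) = (\<Sum>d\<le>N. Polynomial.coeff p d * (A ^\<^sub>m d) $$ (i, j))"
proof -
  have "(\<Sum>d\<le>Polynomial.degree p. Polynomial.coeff p d * (A ^\<^sub>m d) $$ (i, j)) =
        (\<Sum>d\<le>N. Polynomial.coeff p d * (A ^\<^sub>m d) $$ (i, j))"
    using assms(2) by (intro sum.mono_neutral_left) (auto simp: coeff_eq_0)
  then show ?thesis using assms by (auto simp: mat_poly_def)
qed

lemma mat_poly_0 [simp]: "A \<in> carrier_mat n n \<Longrightarrow> mat_poly 0 A = 0\<^sub>m n n"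
  by (rule eq_matI) (auto simp: mat_poly_def)

lemma mat_poly_add:
  assumes A: "A \<in> carrier_mat n n"
  shows "mat_poly (p + q) A = mat_poly p A + mat_poly q A"
proof (rule eq_matI)
  let ?N = "max (Polynomial.degree p) (Polynomial.degree q)"
  fix i j assume "i < dim_row (mat_poly p A + mat_poly q A)" "j < dim_col (mat_poly p A + mat_poly q A)"
  then have ij: "i < n" "j < n" using mat_poly_carrier[OF A, of q] by auto
  have "mat_poly (p + q) A $$ (i, j) = mat_poly p A $$ (i, j) + mat_poly q A $$ (i, j)"
    using ij by (simp add: mat_poly_index[OF A, of _ ?N] degree_add_le ring_distribs sum.distrib)
  then show "mat_poly (p + q) A $$ (i, j) = (mat_poly p A + mat_poly q A) $$ (i, j)"
    using ij mat_poly_carrier[OF A, of q] by auto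
qed (use mat_poly_carrier[OF A] in auto)

lemma mat_poly_smult:
  assumes A: "A \<in> carrier_mat n n"
  shows "mat_poly (Polynomial.smult c p) A = c \<cdot>\<^sub>m mat_poly p A"
proof (rule eq_matI)
  fix i j assume "i < dim_row (c \<cdot>\<^sub>m mat_poly p A)" "j < dim_col (c \<cdot>\<^sub>m mat_poly p A)"
  then have ij: "i < n" "j < n" using mat_poly_carrier[OF A, of p] by auto
  have "mat_poly (Polynomial.smult c p) A $$ (i, j) = c * mat_poly p A $$ (i, j)"
    using ij by (simp add: mat_poly_index[OF A, of _ "Polynomial.degree p"] degree_smult_le
        sum_distrib_left mult.assoc)
  then show "mat_poly (Polynomial.smult c p) A $$ (i, j) = (c \<cdot>\<^sub>m mat_poly p A) $$ (i, j)"
    using ij mat_poly_carrier[OF A, of p] by auto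
qed (use mat_poly_carrier[OF A] in auto)

text \<open>The Horner recursion, from which multiplicativity follows by induction on the polynomial.\<close>

lemma mat_poly_pCons:
  assumes A: "A \<in> carrier_mat n n"
  shows "mat_poly (pCons a p) A = a \<cdot>\<^sub>m 1\<^sub>m n + mat_poly p A * A" (is "?L = ?R")
proof (rule eq_matI)
  let ?N = "Polynomial.degree p"
  fix i j assume "i < dim_row ?R" "j < dim_col ?R"
  then have ij: "i < n" "j < n" using A mat_poly_carrier[OF A, of p] by auto
  have pow: "A ^\<^sub>m d \<in> carrier_mat n n" for d using A by simp
  have Suc: "(A ^\<^sub>m Suc d) $$ (i, j) = (\<Sum>k<n. (A ^\<^sub>m d) $$ (i, k) * A $$ (k, j))" for d
    using ij A pow[of d] by (auto simp: scalar_prod_def lessThan_atLeast0)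
  have "?L $$ (i, j) = a * (1\<^sub>m n) $$ (i, j) + (\<Sum>d\<le>?N. Polynomial.coeff p d * (A ^\<^sub>m Suc d) $$ (i, j))"
    using ij A by (subst mat_poly_index[OF A, of _ "Suc ?N"])
      (auto simp: degree_pCons_le sum.atMost_Suc_shift simp del: sum.atMost_Suc pow_mat.simps(2))
  also have "(\<Sum>d\<le>?N. Polynomial.coeff p d * (A ^\<^sub>m Suc d) $$ (i, j)) =
      (\<Sum>k<n. mat_poly p A $$ (i, k) * A $$ (k, j))"
    unfolding Suc using ij
    by (simp add: mat_poly_index[OF A, of _ ?N] sum_distrib_left sum_distrib_right mult.assoc
        sum.swap[of _ "{..<n}"])
  also have "\<dots> = (mat_poly p A * A) $$ (i, j)"
    using ij A mat_poly_carrier[OF A, of p] by (auto simp: scalar_prod_def lessThan_atLeast0)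
  finally show "?L $$ (i, j) = ?R $$ (i, j)" using ij A mat_poly_carrier[OF A, of p] by auto
qed (use A mat_poly_carrier[OF A] in auto)

lemma mat_poly_1: "A \<in> carrier_mat n n \<Longrightarrow> mat_poly 1 A = 1\<^sub>m n"
  by (simp add: one_pCons mat_poly_pCons[of _ n] left_mult_zero_mat[of _ n n])

lemma mat_poly_x: "A \<in> carrier_mat n n \<Longrightarrow> mat_poly [:0, 1:] A = A"
  by (simp add: mat_poly_pCons[of _ n]) (auto intro: eq_matI)

lemma mat_poly_commutes:
  assumes A: "A \<in> carrier_mat n n"
  shows "A * mat_poly p A = mat_poly p A * A"
proof (induction p)
  case 0 then show ?case using A by simp
next
  case (pCons a p)
  let ?P = "mat_poly p A"
  have P: "?P \<in> carrier_mat n n" using A by simp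
  have one: "1\<^sub>m n \<in> carrier_mat n n" by simp
  have "A * (a \<cdot>\<^sub>m 1\<^sub>m n + ?P * A) = A * (a \<cdot>\<^sub>m 1\<^sub>m n) + A * (?P * A)"
    using A P by (intro mult_add_distrib_mat[of _ n n _ n]) auto
  also have "A * (a \<cdot>\<^sub>m 1\<^sub>m n) = a \<cdot>\<^sub>m 1\<^sub>m n * A"
    using A by (simp add: mult_smult_distrib[OF A one] mult_smult_assoc_mat[OF one A])
  also have "A * (?P * A) = ?P * A * A"
    using A P by (simp add: assoc_mult_mat[of _ n n _ n _ n, symmetric] pCons.IH)
  also have "a \<cdot>\<^sub>m 1\<^sub>m n * A + ?P * A * A = (a \<cdot>\<^sub>m 1\<^sub>m n + ?P * A) * A"
    using A P by (intro add_mult_distrib_mat[of _ n n _ _ n, symmetric]) auto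
  finally show ?case by (simp add: mat_poly_pCons[OF A])
qed

lemma mat_poly_mult:
  assumes A: "A \<in> carrier_mat n n"
  shows "mat_poly (p * q) A = mat_poly p A * mat_poly q A"
proof (induction p)
  case 0 then show ?case using A by (simp add: left_mult_zero_mat[of _ n n])
next
  case (pCons a p)
  let ?P = "mat_poly p A" and ?Q = "mat_poly q A"
  have P: "?P \<in> carrier_mat n n" "?Q \<in> carrier_mat n n" using A by simp_all
  have PQA: "?P * ?Q * A \<in> carrier_mat n n" using A P by auto
  have "mat_poly (pCons a p * q) A = a \<cdot>\<^sub>m ?Q + ?P * ?Q * A"
    using A P by (simp add: mat_poly_add[OF A] mat_poly_smult[OF A] mat_poly_pCons[OF A] pCons.IH
        left_add_zero_mat[OF PQA] zero_smult_mat[of _ n n])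
  also have "?P * ?Q * A = ?P * A * ?Q"
    using A P by (simp add: assoc_mult_mat[of _ n n _ n _ n] mat_poly_commutes[OF A])
  also have "a \<cdot>\<^sub>m ?Q + ?P * A * ?Q = (a \<cdot>\<^sub>m 1\<^sub>m n + ?P * A) * ?Q"
  proof -
    have "(a \<cdot>\<^sub>m 1\<^sub>m n + ?P * A) * ?Q = a \<cdot>\<^sub>m 1\<^sub>m n * ?Q + ?P * A * ?Q"
      using A P by (intro add_mult_distrib_mat[of _ n n _ _ n]) auto
    then show ?thesis
      using mult_smult_assoc_mat[of "1\<^sub>m n" n n ?Q n a] left_mult_one_mat[of ?Q n n] P by simp
  qed
  finally show ?case by (simp add: mat_poly_pCons[OF A])
qed

lemma mat_poly_commutant: "A \<in> carrier_mat n n \<Longrightarrow> mat_poly p A \<in> commutant A"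
  by (auto simp: commutant_iff mat_poly_commutes)

text \<open>The connecting map multiplies by \<open>A\<close> on both sides, which for polynomials in \<open>A\<close> is multiplication
  by \<open>x\<^sup>2\<close>.  This turns equality in the inductive limit into a question about polynomials.\<close>

lemma mat_poly_conn:
  assumes "A \<in> carrier_mat n n"
  shows "(conn A ^^ i) (mat_poly p A) = mat_poly (Polynomial.monom 1 (2 * i) * p) A"
proof (induction i)
  case (Suc i)
  have "(conn A ^^ Suc i) (mat_poly p A) = mat_poly [:0, 1:] A * mat_poly (Polynomial.monom 1 (2 * i) * p) A * mat_poly [:0, 1:] A"
    using assms by (simp add: Suc conn_def mat_poly_x)
  also have "\<dots> = mat_poly ([:0, 1:] * (Polynomial.monom 1 (2 * i) * p) * [:0, 1:]) A"
    using assms by (simp only: mat_poly_mult)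
  also have "[:0, 1:] * (Polynomial.monom 1 (2 * i) * p) * [:0, 1:] = Polynomial.monom 1 (2 * Suc i) * p"
    by (simp add: monom_Suc)
  finally show ?case .
qed (simp add: Polynomial.monom_0)

lemma mat_poly_of_int:
  assumes A: "A \<in> carrier_mat n n"
  shows "mat_poly (of_int_poly p :: 'a :: {comm_ring_1, ring_char_0} poly) (map_mat of_int A) = map_mat of_int (mat_poly p A)"
proof (induction p)
  case 0 then show ?case using A by auto
next
  case (pCons a p)
  have "map_poly of_int (pCons a p) = pCons (of_int a :: 'a) (of_int_poly p)"
    by (rule of_int_hom.map_poly_pCons_hom)
  moreover have "map_mat of_int (mat_poly p A * A) = map_mat of_int (mat_poly p A) * (map_mat of_int A :: 'a mat)"
    using A by (intro of_int_hom.mat_hom_mult[of _ n n]) auto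
  moreover have "map_mat of_int (a \<cdot>\<^sub>m 1\<^sub>m n + M) = of_int a \<cdot>\<^sub>m 1\<^sub>m n + (map_mat of_int M :: 'a mat)"
    if "M \<in> carrier_mat n n" for M
    using that by (auto intro!: eq_matI)
  ultimately show ?case using A
    by (simp add: mat_poly_pCons[of _ n] pCons.IH mult_carrier_mat[of _ n n])
qed

section \<open>The integral minimal polynomial of an integer matrix\<close>

lemma mat_poly_sum_index:
  assumes A: "A \<in> carrier_mat n n" and ij: "i < n" "j < n"
  shows "mat_poly (\<Sum>t\<in>T. f t) A $$ (i, j) = (\<Sum>t\<in>T. mat_poly (f t) A $$ (i, j))"
proof (induction T rule: infinite_finite_induct)
  case (insert t T)
  then show ?case using A ij by (simp add: mat_poly_add[OF A])
qed (use A ij in auto)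

text \<open>The adjugate argument.  Let polynomials act on vectors by \<open>p \<bullet> v = p(A) v\<close>, and
  let \<open>M = x I - A\<close>.  Then \<open>\<Sum>\<^sub>i M\<^sub>i\<^sub>j \<bullet> e\<^sub>i = A e\<^sub>j - \<Sum>\<^sub>i A\<^sub>i\<^sub>j e\<^sub>i = 0\<close> for every \<open>j\<close>.  Applying the entries of the
  adjugate \<open>B\<close> of \<open>M\<close> and summing over \<open>j\<close> gives \<open>\<Sum>\<^sub>i (M B)\<^sub>i\<^sub>k \<bullet> e\<^sub>i = 0\<close>, and \<open>M B\<close> is the scalar matrix with
  the characteristic polynomial on the diagonal.\<close>

theorem Cayley_Hamilton_mat:
  assumes A: "(A :: 'a :: comm_ring_1 mat) \<in> carrier_mat n n"
  shows "mat_poly (char_poly A) A = 0\<^sub>m n n"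
proof (rule eq_matI)
  define M where "M = char_poly_matrix A"
  define B where "B = adj_mat M"
  have M: "M \<in> carrier_mat n n" using A by (simp add: M_def)
  have B: "B \<in> carrier_mat n n" and MB: "M * B = char_poly A \<cdot>\<^sub>m 1\<^sub>m n"
    using adj_mat[OF M] by (simp_all add: B_def M_def char_poly_def)
  have M_index: "M $$ (i, j) = (if i = j then [:0, 1:] else 0) - [:A $$ (i, j):]" if "i < n" "j < n" for i j
    using that A by (auto simp: M_def char_poly_matrix_def)
  have M_eval: "mat_poly (M $$ (i, j)) A $$ (r, i) =
      (if i = j then A $$ (r, j) else 0) - (if i = r then A $$ (r, j) else 0)"
    if "i < n" "j < n" "r < n" for i j r
    using that A by (cases "i = j")
     (auto simp: M_index mat_poly_pCons[OF A] left_mult_zero_mat[of _ n n])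
  \<comment> \<open>This is \<open>A e\<^sub>j = \<Sum>\<^sub>i A\<^sub>i\<^sub>j e\<^sub>i\<close>, read off in the coordinate \<open>r\<close>.\<close>
  have column: "(\<Sum>i<n. mat_poly (M $$ (i, j)) A $$ (r, i)) = 0" if "j < n" "r < n" for j r
    using that by (simp add: M_eval sum_subtractf)
  fix r k assume "r < dim_row (0\<^sub>m n n :: 'a mat)" "k < dim_col (0\<^sub>m n n :: 'a mat)"
  then have rk: "r < n" "k < n" by auto
  have "mat_poly (char_poly A) A $$ (r, k) = (\<Sum>i<n. mat_poly ((M * B) $$ (i, k)) A $$ (r, i))"
  proof -
    have "mat_poly ((M * B) $$ (i, k)) A $$ (r, i) = (if i = k then mat_poly (char_poly A) A $$ (r, k) else 0)"
      if "i < n" for i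
      using that rk A by (auto simp: MB)
    then show ?thesis using rk by simp
  qed
  also have "\<dots> = (\<Sum>i<n. \<Sum>j<n. mat_poly (B $$ (j, k) * M $$ (i, j)) A $$ (r, i))"
    using M B rk by (intro sum.cong)
      (auto simp: scalar_prod_def lessThan_atLeast0 mult.commute mat_poly_sum_index[OF A])
  also have "\<dots> = (\<Sum>i<n. \<Sum>j<n. \<Sum>s<n. mat_poly (B $$ (j, k)) A $$ (r, s) * mat_poly (M $$ (i, j)) A $$ (s, i))"
    using A rk by (intro sum.cong) (auto simp: mat_poly_mult[OF A] scalar_prod_def lessThan_atLeast0)
  also have "\<dots> = (\<Sum>j<n. \<Sum>s<n. mat_poly (B $$ (j, k)) A $$ (r, s) * (\<Sum>i<n. mat_poly (M $$ (i, j)) A $$ (s, i)))"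
  proof -
    have "(\<Sum>i<n. \<Sum>j<n. \<Sum>s<n. f i j s) = (\<Sum>j<n. \<Sum>s<n. \<Sum>i<n. f i j s)" for f :: "nat \<Rightarrow> nat \<Rightarrow> nat \<Rightarrow> 'a"
      by (subst sum.swap) (intro sum.cong refl sum.swap)
    from this[of "\<lambda>i j s. mat_poly (B $$ (j, k)) A $$ (r, s) * mat_poly (M $$ (i, j)) A $$ (s, i)"]
    show ?thesis by (simp add: sum_distrib_left)
  qed
  also have "\<dots> = 0" by (simp add: column)
  finally show "mat_poly (char_poly A) A $$ (r, k) = 0\<^sub>m n n $$ (r, k)" using rk by simp
qed (use A in auto)

lemma clear_denominators:
  "\<exists>D q. (D :: int) > 0 \<and> Polynomial.smult (of_int D) (p :: rat poly) = of_int_poly q"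
proof (induction p)
  case 0
  show ?case by (intro exI[of _ 1] exI[of _ 0]) auto
next
  case (pCons a p)
  then obtain D q where D: "D > 0" "Polynomial.smult (of_int D) p = of_int_poly q" by blast
  obtain x y where xy: "quotient_of a = (x, y)" by force
  have y: "y > 0" using quotient_of_denom_pos[OF xy] .
  have a: "a = of_int x / of_int y" using quotient_of_div[OF xy] .
  have "Polynomial.smult (of_int (y * D)) (pCons a p) =
    pCons (of_int (D * x)) (Polynomial.smult (of_int y) (of_int_poly q))"
    using y by (simp add: a D(2)[symmetric])
  also have "\<dots> = of_int_poly (pCons (D * x) (Polynomial.smult y q))"
    by (simp add: of_int_hom.map_poly_pCons_hom hom_distribs)
  finally show ?case using y D(1) by (intro exI[of _ "y * D"]) auto
qed

text \<open>Clear denominators in both factors, \<open>D m = M\<close> and \<open>E s = S\<close>, so that \<open>M S = D E h\<close>.  A monic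
  polynomial has content \<open>1\<close>, hence \<open>content M \<cdot> content S = D E\<close> because content is multiplicative.
  The content of \<open>S\<close> divides its leading coefficient \<open>E\<close>, so \<open>D\<close> divides the content of \<open>M\<close>, and
  \<open>m = M / D\<close> is integral.\<close>

lemma monic_rat_factor_of_monic_int_poly:
  fixes m s :: "rat poly" and h :: "int poly"
  assumes m: "Polynomial.lead_coeff m = 1" and h: "Polynomial.lead_coeff h = 1"
    and eq: "m * s = of_int_poly h"
  obtains q where "m = of_int_poly q"
proof -
  obtain D M where D: "D > 0" "Polynomial.smult (of_int D) m = of_int_poly M"
    using clear_denominators by blast
  obtain E S where E: "E > 0" "Polynomial.smult (of_int E) s = of_int_poly S"
    using clear_denominators by blast
  have "Polynomial.lead_coeff (m * s) = 1" unfolding eq using h by simp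
  then have s: "Polynomial.lead_coeff s = 1" by (simp add: Polynomial.lead_coeff_mult m)
  have "of_int_poly (M * S) = Polynomial.smult (of_int (D * E)) (m * s)"
    by (simp add: hom_distribs mult.commute flip: D(2) E(2))
  also have "\<dots> = of_int_poly (Polynomial.smult (D * E) h)" by (simp add: eq hom_distribs)
  finally have MS: "M * S = Polynomial.smult (D * E) h" by simp
  have "content h dvd 1" using content_dvd_coeff[of h "Polynomial.degree h"] h by simp
  then have ch: "content h = 1" by (metis normalize_content is_unit_normalize)
  have cMS: "content M * content S = D * E"
    using arg_cong[OF MS, of content] D(1) E(1) ch by (simp add: content_mult)
  have "(of_int (Polynomial.lead_coeff S) :: rat) = of_int E"
    using arg_cong[OF E(2), of Polynomial.lead_coeff] s E(1) by auto
  then have "content S dvd E"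
    using content_dvd_coeff[of S "Polynomial.degree S"] by auto
  then obtain b where b: "E = content S * b" by (auto elim: dvdE)
  have "content S \<noteq> 0" using b E(1) by auto
  then have "content M = D * b" using cMS b by (simp add: ac_simps)
  then have "D dvd content M" by simp
  then have "M = Polynomial.smult D (Polynomial.smult (content M div D) (primitive_part M))"
    using D(1) by simp
  then obtain q where q: "M = Polynomial.smult D q" by blast
  have "Polynomial.smult (of_int D) m = Polynomial.smult (of_int D) (of_int_poly q)"
    by (simp add: D(2) q hom_distribs)
  then have "m = of_int_poly q" using D(1) by (auto simp: smult_eq_iff)
  then show ?thesis by (rule that)
qed

lemma minimal_poly_dvd:
  assumes B: "(B :: 'a :: field mat) \<in> carrier_mat n n" and m: "is_minimal_poly B m"
    and h: "mat_poly h B = 0\<^sub>m n n"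
  shows "m dvd h"
proof -
  have mB: "mat_poly m B = 0\<^sub>m n n" and m0: "m \<noteq> 0" using m B by (auto simp: is_minimal_poly_def)
  have "mat_poly h B = mat_poly (m * (h div m)) B + mat_poly (h mod m) B"
    by (simp flip: mat_poly_add[OF B])
  then have "mat_poly (h mod m) B = 0\<^sub>m n n"
    using B by (simp add: h mat_poly_mult[OF B] mB left_mult_zero_mat[of _ n n])
  then have "h mod m = 0 \<or> Polynomial.degree m \<le> Polynomial.degree (h mod m)"
    using m B by (auto simp: is_minimal_poly_def)
  then have "h mod m = 0" using degree_mod_less[OF m0, of h] by auto
  then show ?thesis by auto
qed

text \<open>Division with remainder by a monic polynomial stays inside \<open>\<int>[x]\<close>, and the remainder is the one
  obtained over \<open>\<rat>\<close>.\<close>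

lemma monic_int_poly_dvd:
  fixes q h :: "int poly"
  assumes q: "Polynomial.lead_coeff q = 1" and dvd: "(of_int_poly q :: rat poly) dvd of_int_poly h"
  shows "q dvd h"
proof -
  have q0: "q \<noteq> 0" using q by auto
  obtain u r where ur: "pseudo_divmod h q = (u, r)" by force
  have h: "h = q * u + r" and r: "r = 0 \<or> Polynomial.degree r < Polynomial.degree q"
    using pseudo_divmod[OF q0 ur] q by auto
  have "of_int_poly h = of_int_poly q * of_int_poly u + (of_int_poly r :: rat poly)"
    unfolding h by (simp add: hom_distribs)
  then have "(of_int_poly q :: rat poly) dvd of_int_poly r" using dvd by (simp add: dvd_add_right_iff)
  then have "r = 0" using r by (metis dvd_imp_degree_le of_int_hom.degree_map_poly_hom of_int_poly_hom.hom_0_iff not_less)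
  then show ?thesis using h by simp
qed

text \<open>The polynomials that annihilate an integer matrix form a principal ideal even in \<open>\<int>[x]\<close>, which is
  not a principal ideal domain, because the generator over \<open>\<rat>\<close> is monic and integral.\<close>

theorem integral_minimal_poly:
  fixes A :: "int mat"
  assumes A: "A \<in> carrier_mat n n" and m: "is_minimal_poly (map_mat of_int A) (m :: rat poly)"
  obtains M where "m = of_int_poly M" "Polynomial.lead_coeff M = 1"
    "\<And>h. mat_poly h A = 0\<^sub>m n n \<longleftrightarrow> M dvd h"
proof -
  let ?A = "map_mat of_int A :: rat mat"
  have A': "?A \<in> carrier_mat n n" using A by simp
  have lift: "mat_poly (of_int_poly h) ?A = 0\<^sub>m n n" if "mat_poly h A = 0\<^sub>m n n" for h
    using that by (auto simp: mat_poly_of_int[OF A] intro!: eq_matI)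
  have "m dvd of_int_poly (char_poly A)"
    by (rule minimal_poly_dvd[OF A' m lift[OF Cayley_Hamilton_mat[OF A]]])
  then obtain s where s: "m * s = of_int_poly (char_poly A)" by (metis dvdE)
  have lm: "Polynomial.lead_coeff m = 1" using m by (simp add: is_minimal_poly_def)
  obtain M where M: "m = of_int_poly M"
    using monic_rat_factor_of_monic_int_poly[OF lm _ s] degree_monic_char_poly[OF A] by auto
  have lM: "Polynomial.lead_coeff M = 1" using lm by (simp add: M)
  have "mat_poly M A = 0\<^sub>m n n"
  proof -
    have "map_mat of_int (mat_poly M A) = (0\<^sub>m n n :: rat mat)"
      using m A by (simp add: is_minimal_poly_def M mat_poly_of_int[OF A])
    then show ?thesis using A by (auto simp: mat_eq_iff)
  qed
  then have "mat_poly h A = 0\<^sub>m n n \<longleftrightarrow> M dvd h" for h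
    using minimal_poly_dvd[OF A' m lift] monic_int_poly_dvd[OF lM] A
    by (auto simp: M mat_poly_mult[OF A] left_mult_zero_mat[of _ n n])
  then show ?thesis using that M lM by blast
qed

section \<open>Laurent polynomials as fractions of polynomials\<close>

abbreviation xpow :: "int \<Rightarrow> (int \<Rightarrow>\<^sub>0 int)" where
  "xpow n \<equiv> Poly_Mapping.single n 1"

lemma xpow_power: "xpow 1 ^ n = xpow (int n)"
  by (induction n) (simp_all add: mult_single add.commute)

lemma xpow_cancel: "xpow (- n) * (xpow n * f) = f"
proof -
  have "xpow (- n) * (xpow n * f) = (xpow (- n) * xpow n) * f" by (simp only: mult.assoc)
  then show ?thesis by (simp add: mult_single)
qed

text \<open>The inclusion \<open>\<int>[x] \<subseteq> \<int>[x, x\<^sup>-\<^sup>1]\<close>.  As an evaluation map it is visibly a ring homomorphism; that it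
  preserves coefficients, and hence is injective, is derived below.\<close>

definition laurent_of_poly :: "int poly \<Rightarrow> (int \<Rightarrow>\<^sub>0 int)" where
  "laurent_of_poly p = Polynomial.poly (of_int_poly p) (xpow 1)"

lemma laurent_of_poly_add: "laurent_of_poly (p + q) = laurent_of_poly p + laurent_of_poly q"
  and laurent_of_poly_diff: "laurent_of_poly (p - q) = laurent_of_poly p - laurent_of_poly q"
  and laurent_of_poly_mult: "laurent_of_poly (p * q) = laurent_of_poly p * laurent_of_poly q"
  and laurent_of_poly_0: "laurent_of_poly 0 = 0"
  and laurent_of_poly_1: "laurent_of_poly 1 = 1"
  by (simp_all only: laurent_of_poly_def of_int_poly_hom.hom_add of_int_poly_hom.hom_minus
      of_int_poly_hom.hom_mult of_int_poly_hom.hom_zero of_int_poly_hom.hom_one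
      poly_add poly_diff poly_mult poly_0 poly_1)

lemma laurent_of_poly_sum: "laurent_of_poly (\<Sum>t\<in>T. f t) = (\<Sum>t\<in>T. laurent_of_poly (f t))"
  by (induction T rule: infinite_finite_induct) (simp_all add: laurent_of_poly_0 laurent_of_poly_add)

lemma single_eq_of_int_mult_xpow: "Poly_Mapping.single n c = of_int c * xpow n"
proof -
  have "Poly_Mapping.single n c = Poly_Mapping.single 0 c * xpow n" by (simp add: mult_single)
  moreover have "Poly_Mapping.single 0 c = (of_int c :: int \<Rightarrow>\<^sub>0 int)"
    using single_of_int[of c, where 'b = int] by (simp del: single_of_int)
  ultimately show ?thesis by simp
qed

lemma laurent_of_poly_monom:
  "laurent_of_poly (Polynomial.monom c n) = Poly_Mapping.single (int n) c"
  unfolding single_eq_of_int_mult_xpow[of "int n" c]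
  by (simp add: laurent_of_poly_def Polynomial.poly_monom xpow_power)

lemma lookup_laurent_of_poly:
  "Poly_Mapping.lookup (laurent_of_poly p) (int n) = Polynomial.coeff p n"
proof -
  have "laurent_of_poly p = (\<Sum>i\<le>Polynomial.degree p. Poly_Mapping.single (int i) (Polynomial.coeff p i))"
    by (subst poly_as_sum_of_monoms[of p, symmetric])
      (simp only: laurent_of_poly_sum laurent_of_poly_monom)
  then have "Poly_Mapping.lookup (laurent_of_poly p) (int n) =
      (\<Sum>i\<le>Polynomial.degree p. if i = n then Polynomial.coeff p i else 0)"
    by (simp add: lookup_sum lookup_single when_def)
  then show ?thesis by (simp add: coeff_eq_0)
qed

lemma laurent_of_poly_inj: "laurent_of_poly p = laurent_of_poly q \<longleftrightarrow> p = q"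
  by (metis lookup_laurent_of_poly poly_eq_iff)

text \<open>The variable \<open>x\<close> is a prime of \<open>\<int>[x]\<close> that does not divide \<open>p\<close>: if \<open>x g = p s\<close>, then \<open>s\<close> has constant
  term \<open>0\<close>, and one factor \<open>x\<close> cancels.\<close>

lemma dvd_monom_mult_cancel:
  fixes p g :: "int poly"
  assumes p0: "Polynomial.coeff p 0 \<noteq> 0" and dvd: "p dvd Polynomial.monom 1 i * g"
  shows "p dvd g"
  using dvd
proof (induction i)
  case 0 then show ?case by (simp add: Polynomial.monom_0)
next
  case (Suc i)
  then obtain s where s: "pCons 0 (Polynomial.monom 1 i * g) = p * s"
    by (auto simp: monom_Suc elim: dvdE)
  then have "Polynomial.coeff (p * s) 0 = 0" by (metis coeff_pCons_0)
  then have "Polynomial.coeff s 0 = 0" using p0 by (simp add: coeff_mult_0)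
  then obtain s' where "s = pCons 0 s'" by (cases s) auto
  then have "Polynomial.monom 1 i * g = p * s'" using s by simp
  then show ?case by (intro Suc.IH) simp
qed

text \<open>\<open>f = x\<^sup>-\<^sup>2\<^sup>N g\<close>.  Only even powers of \<open>x\<close> are used as denominators because passing to the next group of
  the inductive limit multiplies by \<open>A\<close> on both sides, so that the level \<open>N\<close> accounts for \<open>x\<^sup>-\<^sup>2\<^sup>N\<close>.\<close>

definition has_numerator :: "(int \<Rightarrow>\<^sub>0 int) \<Rightarrow> nat \<Rightarrow> int poly \<Rightarrow> bool" where
  "has_numerator f N g \<longleftrightarrow> f * xpow (2 * int N) = laurent_of_poly g"

lemma has_numerator_poly: "has_numerator (laurent_of_poly g) 0 g"
  by (simp add: has_numerator_def)

lemma has_numerator_xpow: "- n \<le> 2 * int N \<Longrightarrow> has_numerator (xpow n) N (Polynomial.monom 1 (nat (n + 2 * int N)))"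
  by (simp add: has_numerator_def mult_single laurent_of_poly_monom)

lemma has_numerator_raise:
  assumes "has_numerator f N g"
  shows "has_numerator f (N + M) (Polynomial.monom 1 (2 * M) * g)"
proof -
  have "f * xpow (2 * int (N + M)) = xpow (int (2 * M)) * (f * xpow (2 * int N))"
    unfolding mult.left_commute[of "xpow (int (2 * M))" f] by (simp add: mult_single algebra_simps)
  then show ?thesis using assms
    by (simp only: has_numerator_def laurent_of_poly_mult laurent_of_poly_monom)
qed

lemma has_numerator_add: "has_numerator f N g \<Longrightarrow> has_numerator f' N g' \<Longrightarrow> has_numerator (f + f') N (g + g')"
  and has_numerator_diff: "has_numerator f N g \<Longrightarrow> has_numerator f' N g' \<Longrightarrow> has_numerator (f - f') N (g - g')"
  by (simp_all add: has_numerator_def laurent_of_poly_add laurent_of_poly_diff algebra_simps)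

lemma has_numerator_mult:
  assumes "has_numerator f N g" "has_numerator f' N' g'"
  shows "has_numerator (f * f') (N + N') (g * g')"
proof -
  have "f * f' * xpow (2 * int (N + N')) = f * f' * (xpow (2 * int N) * xpow (2 * int N'))"
    by (simp add: mult_single algebra_simps)
  also have "\<dots> = (f * xpow (2 * int N)) * (f' * xpow (2 * int N'))" by (simp only: ac_simps)
  finally show ?thesis using assms by (simp only: has_numerator_def laurent_of_poly_mult)
qed

lemma has_numerator_unique: "has_numerator f N g \<Longrightarrow> has_numerator f N h \<Longrightarrow> g = h"
  by (simp add: has_numerator_def laurent_of_poly_inj)

text \<open>Integer combinations of powers of \<open>x\<close> are reached from the powers by subtraction alone.\<close>

lemma has_numerator_exists: "\<exists>N g. has_numerator f N g"
proof (induction f rule: frag_induction[OF subset_UNIV, case_names zero one diff])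
  case zero
  show ?case using has_numerator_poly[of 0] by (auto simp: laurent_of_poly_0)
next
  case (one n)
  show ?case by (intro exI, rule has_numerator_xpow[of n "nat \<bar>n\<bar>"]) auto
next
  case (diff f f')
  then obtain N g N' g' where "has_numerator f N g" "has_numerator f' N' g'" by blast
  from has_numerator_diff[OF has_numerator_raise[OF this(1), of N'], of f']
    has_numerator_raise[OF this(2), of N]
  show ?case by (auto simp: add.commute)
qed

section \<open>Evaluation of Laurent polynomials in the inductive limit\<close>

text \<open>The value of \<open>f\<close> at the unit \<open>u = [A, 0]\<close>.  All numerators of \<open>f\<close> lead to the same class, so the
  choice is harmless.\<close>

definition laurent_eval :: "int mat \<Rightarrow> (int \<Rightarrow>\<^sub>0 int) \<Rightarrow> (int mat \<times> nat) set" where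
  "laurent_eval A f = (SOME P. \<exists>N g. has_numerator f N g \<and> P = lim_class A (mat_poly g A) N)"

context
  fixes A :: "int mat" and n :: nat
  assumes A: "A \<in> carrier_mat n n"
begin

lemmas K0 = ring_K0_ring[OF A]

text \<open>If \<open>x\<^sup>-\<^sup>2\<^sup>N g = x\<^sup>-\<^sup>2\<^sup>M h\<close>, then \<open>x\<^sup>2\<^sup>M g = x\<^sup>2\<^sup>N h\<close>, which says that \<open>[g(A), N]\<close> and \<open>[h(A), M]\<close> become equal in
  the group with index \<open>N + M\<close>.\<close>

lemma laurent_eval:
  assumes f: "has_numerator f N g"
  shows "laurent_eval A f = lim_class A (mat_poly g A) N"
  unfolding laurent_eval_def
proof (rule some_equality)
  fix P assume "\<exists>N g. has_numerator f N g \<and> P = lim_class A (mat_poly g A) N"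
  then obtain M h where h: "has_numerator f M h" and P: "P = lim_class A (mat_poly h A) M" by blast
  have "Polynomial.monom 1 (2 * N) * h = Polynomial.monom 1 (2 * M) * g"
    using has_numerator_raise[OF h, of N] has_numerator_raise[OF f, of M]
    by (intro has_numerator_unique) (auto simp: add.commute)
  then show "P = lim_class A (mat_poly g A) N"
    unfolding P by (intro lim_class_eqI[OF A mat_poly_commutant[OF A] mat_poly_commutant[OF A], of _ N _ M])
      (simp_all add: mat_poly_conn[OF A] add.commute)
qed (use f in blast)

lemma laurent_eval_carrier: "laurent_eval A f \<in> carrier (K0_ring A)"
proof -
  obtain N g where "has_numerator f N g" using has_numerator_exists by blast
  then show ?thesis using laurent_eval lim_class_carrier[OF A mat_poly_commutant[OF A]] by metis
qed

lemma laurent_eval_add: "laurent_eval A (f + f') = laurent_eval A f \<oplus>\<^bsub>K0_ring A\<^esub> laurent_eval A f'"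
proof -
  obtain N g N' g' where *: "has_numerator f N g" "has_numerator f' N' g'"
    using has_numerator_exists by blast
  have "has_numerator (f + f') (N + N') (Polynomial.monom 1 (2 * N') * g + Polynomial.monom 1 (2 * N) * g')"
    using has_numerator_raise[OF *(1), of N'] has_numerator_raise[OF *(2), of N]
    by (intro has_numerator_add) (auto simp: add.commute)
  from laurent_eval[OF this] laurent_eval[OF *(1)] laurent_eval[OF *(2)] show ?thesis
    by (simp add: K0_ring_add[OF A] mat_poly_commutant[OF A] mat_poly_conn[OF A] mat_poly_add[OF A])
qed

lemma laurent_eval_mult: "laurent_eval A (f * f') = laurent_eval A f \<otimes>\<^bsub>K0_ring A\<^esub> laurent_eval A f'"
proof -
  obtain N g N' g' where *: "has_numerator f N g" "has_numerator f' N' g'"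
    using has_numerator_exists by blast
  from laurent_eval[OF has_numerator_mult[OF this]] laurent_eval[OF *(1)] laurent_eval[OF *(2)]
  show ?thesis by (simp add: K0_ring_mult[OF A] mat_poly_commutant[OF A] mat_poly_mult[OF A])
qed

lemma laurent_eval_1: "laurent_eval A 1 = \<one>\<^bsub>K0_ring A\<^esub>"
  using laurent_eval[OF has_numerator_poly[of 1]]
  by (simp add: laurent_of_poly_1 K0_one[OF A] mat_poly_1[OF A])

lemma laurent_eval_x: "laurent_eval A (xpow 1) = lim_class A A 0"
  using laurent_eval[OF has_numerator_xpow[of 1 0]]
  by (simp add: monom_Suc Polynomial.monom_0 mat_poly_x[OF A])

lemma laurent_eval_x_inv: "laurent_eval A (xpow (-1)) = lim_class A A 1"
  using laurent_eval[OF has_numerator_xpow[of "-1" 1]]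
  by (simp add: monom_Suc Polynomial.monom_0 mat_poly_x[OF A])

lemma laurent_eval_hom: "ring_hom_ring laurent_ring (K0_ring A) (laurent_eval A)"
  by (rule ring_hom_ringI[OF class_ring.ring_axioms K0])
    (simp_all add: laurent_eval_carrier laurent_eval_mult laurent_eval_add laurent_eval_1)

text \<open>The image is a subring that contains both generators \<open>u\<close> and \<open>u\<^sup>-\<^sup>1\<close>; conversely, every value is an
  integer combination of powers of \<open>u\<close>.\<close>

lemma laurent_eval_image: "range (laurent_eval A) = carrier (R_ring A)"
proof -
  interpret K0: ring "K0_ring A" by (rule K0)
  interpret hom: ring_hom_ring laurent_ring "K0_ring A" "laurent_eval A" by (rule laurent_eval_hom)
  let ?H = "{lim_class A A 0, lim_class A A 1}" and ?R = "generate_ring (K0_ring A)"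
  have H: "?H \<subseteq> range (laurent_eval A)"
    using laurent_eval_x laurent_eval_x_inv by (auto simp: image_iff)
  have "?R ?H \<subseteq> range (laurent_eval A)"
  proof (rule K0.generate_ring_min_subring1[OF _ _ H])
    show "?H \<subseteq> carrier (K0_ring A)" using H laurent_eval_carrier by auto
    show "subring (range (laurent_eval A)) (K0_ring A)"
      using hom.img_is_subring[OF ring.carrier_is_subring[OF class_ring.ring_axioms]] by simp
  qed
  moreover have "laurent_eval A f \<in> ?R ?H" for f
  proof (induction f rule: frag_induction[OF subset_UNIV, case_names zero one diff])
    case zero
    then show ?case using hom.hom_zero K0.zero_in_generate by simp
  next
    case (one z)
    show ?case
    proof (induction z rule: int_induct[of _ 0])
      case base
      then show ?case by (simp add: laurent_eval_1 generate_ring.one)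
    next
      case (step1 i)
      have "xpow (i + 1) = xpow i * xpow 1" by (simp add: mult_single)
      then show ?case using step1.IH
        by (simp add: laurent_eval_mult laurent_eval_x generate_ring.eng_mult generate_ring.incl)
    next
      case (step2 i)
      have "xpow (i - 1) = xpow i * xpow (-1)" by (simp add: mult_single)
      then show ?case using step2.IH
        by (simp add: laurent_eval_mult laurent_eval_x_inv generate_ring.eng_mult generate_ring.incl)
    qed
  next
    case (diff f f')
    have "laurent_eval A (- f') \<oplus>\<^bsub>K0_ring A\<^esub> laurent_eval A f' = \<zero>\<^bsub>K0_ring A\<^esub>"
      using laurent_eval_add[of "- f'" f'] hom.hom_zero by simp
    then have "laurent_eval A (- f') = \<ominus>\<^bsub>K0_ring A\<^esub> laurent_eval A f'"
      using K0.minus_equality laurent_eval_carrier by metis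
    then show ?case using diff laurent_eval_add[of f "- f'"]
      by (simp add: generate_ring.eng_add generate_ring.a_inv)
  qed
  ultimately show ?thesis by (auto simp: R_ring_def)
qed

text \<open>Zero has a representative \<open>0\<close> in every group of the limit.  Choosing the one in the group with index
  \<open>N\<close> makes the connecting maps on both sides equally many, and they send \<open>0\<close> to \<open>0\<close>.\<close>

lemma laurent_eval_eq_0_iff:
  assumes "has_numerator f N g"
  shows "laurent_eval A f = \<zero>\<^bsub>K0_ring A\<^esub> \<longleftrightarrow> (\<exists>i. mat_poly (Polynomial.monom 1 (2 * i) * g) A = 0\<^sub>m n n)"
proof -
  have zero: "(conn A ^^ j) (0\<^sub>m n n) = 0\<^sub>m n n" for j
    using mat_poly_conn[OF A, of j 0] by (simp add: mat_poly_0[OF A])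
  have "laurent_eval A f = \<zero>\<^bsub>K0_ring A\<^esub> \<longleftrightarrow> lim_class A (mat_poly g A) N = lim_class A (0\<^sub>m n n) N"
    by (simp add: laurent_eval[OF assms] K0_zero[OF A, of N])
  also have "\<dots> \<longleftrightarrow> (\<exists>i. mat_poly (Polynomial.monom 1 (2 * i) * g) A = 0\<^sub>m n n)"
    by (subst lim_class_eq_iff[OF A mat_poly_commutant[OF A] commutant_zero[OF A]])
      (simp add: zero mat_poly_conn[OF A])
  finally show ?thesis .
qed

text \<open>The nilpotent part \<open>x\<^sup>l\<close> of the minimal polynomial disappears in the quotient: \<open>x\<close> is a unit in the
  Laurent ring, and on the side of the matrices finitely many applications of \<open>A\<close> do not change
  whether a class is zero.\<close>

lemma R_ring_iso_laurent_quotient: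
  fixes p :: "int poly"
  assumes min: "\<And>h. mat_poly h A = 0\<^sub>m n n \<longleftrightarrow> Polynomial.monom 1 l * p dvd h"
    and p0: "Polynomial.coeff p 0 \<noteq> 0"
  shows "R_ring A \<simeq> laurent_ring Quot (PIdl\<^bsub>laurent_ring\<^esub> (laurent_of_poly p))"
proof -
  interpret K0: ring "K0_ring A" by (rule K0)
  interpret hom: ring_hom_ring laurent_ring "K0_ring A" "laurent_eval A" by (rule laurent_eval_hom)
  have ker: "laurent_eval A f = \<zero>\<^bsub>K0_ring A\<^esub> \<longleftrightarrow> (\<exists>y. f = y * laurent_of_poly p)" for f
  proof
    assume 0: "laurent_eval A f = \<zero>\<^bsub>K0_ring A\<^esub>"
    obtain N g where g: "has_numerator f N g" using has_numerator_exists by blast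
    obtain i where "Polynomial.monom 1 l * p dvd Polynomial.monom 1 (2 * i) * g"
      using 0 laurent_eval_eq_0_iff[OF g] min by blast
    then have "p dvd Polynomial.monom 1 (2 * i) * g" by (rule dvd_mult_right)
    then have "p dvd g" by (rule dvd_monom_mult_cancel[OF p0])
    then obtain s where s: "g = s * p" by (metis dvdE mult.commute)
    have "f = xpow (- (2 * int N)) * (f * xpow (2 * int N))"
      by (simp add: xpow_cancel mult.commute[of f])
    also have "\<dots> = xpow (- (2 * int N)) * laurent_of_poly s * laurent_of_poly p"
      using g by (simp add: has_numerator_def s laurent_of_poly_mult mult.assoc)
    finally show "\<exists>y. f = y * laurent_of_poly p" by blast
  next
    assume "\<exists>y. f = y * laurent_of_poly p"
    then obtain y where y: "f = y * laurent_of_poly p" by blast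
    obtain N g where "has_numerator y N g" using has_numerator_exists by blast
    then have f: "has_numerator f N (g * p)"
      using has_numerator_mult[OF _ has_numerator_poly] by (fastforce simp: y)
    \<comment> \<open>After \<open>l\<close> connecting maps the factor \<open>x\<^sup>2\<^sup>l\<close> is available, which contains \<open>x\<^sup>l\<close>.\<close>
    have "Polynomial.monom 1 l * p dvd Polynomial.monom 1 (2 * l) * (g * p)"
    proof (intro mult_dvd_mono)
      have "Polynomial.monom (1 :: int) (2 * l) = Polynomial.monom 1 l * Polynomial.monom 1 l"
        by (simp add: Polynomial.mult_monom mult_2)
      then show "Polynomial.monom (1 :: int) l dvd Polynomial.monom 1 (2 * l)" by simp
    qed simp
    then show "laurent_eval A f = \<zero>\<^bsub>K0_ring A\<^esub>"
      using laurent_eval_eq_0_iff[OF f] min by blast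
  qed
  have gen: "subring (carrier (R_ring A)) (K0_ring A)"
    using hom.img_is_subring[OF ring.carrier_is_subring[OF class_ring.ring_axioms]] by (simp add: laurent_eval_image)
  have R: "R_ring A = (K0_ring A)\<lparr>carrier := carrier (R_ring A)\<rparr>" by (simp add: R_ring_def)
  have ring_R: "ring (R_ring A)" using K0.subring_is_ring[OF gen] R by simp
  have hom_R: "ring_hom_ring laurent_ring (R_ring A) (laurent_eval A)"
    using laurent_eval_image
    by (intro ring_hom_ringI[OF class_ring.ring_axioms ring_R])
      (auto simp: R_ring_def laurent_eval_mult laurent_eval_add laurent_eval_1)
  have kernel: "a_kernel laurent_ring (R_ring A) (laurent_eval A) = PIdl\<^bsub>laurent_ring\<^esub> (laurent_of_poly p)"
  proof -
    have "\<zero>\<^bsub>R_ring A\<^esub> = \<zero>\<^bsub>K0_ring A\<^esub>" by (simp add: R_ring_def)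
    then show ?thesis unfolding a_kernel_def' cgenideal_def by (simp add: ker)
  qed
  then have "laurent_ring Quot (PIdl\<^bsub>laurent_ring\<^esub> (laurent_of_poly p)) \<simeq> R_ring A"
    using ring_hom_ring.FactRing_iso[OF hom_R] laurent_eval_image by simp
  moreover have "ring (laurent_ring Quot (PIdl\<^bsub>laurent_ring\<^esub> (laurent_of_poly p)))"
    using ideal.quotient_is_ring[OF ring_hom_ring.kernel_is_ideal[OF hom_R]] kernel by simp
  ultimately show ?thesis by (rule ring_iso_sym[rotated])
qed

end

section \<open>The ring generated by the shift\<close>

theorem proposition1p10:
  fixes A :: "int mat" and K k l :: nat and a :: "nat \<Rightarrow> rat"
  assumes "A \<in> carrier_mat K K"
    and "primitive_mat A"
    and "is_minimal_poly (map_mat of_int A)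
           (Polynomial.monom 1 l * (Polynomial.monom 1 k + (\<Sum>i<k. Polynomial.monom (a i) i)))"
    and "a 0 \<noteq> 0"
  shows "\<exists>c :: nat \<Rightarrow> int. (\<forall>i<k. a i = of_int (c i)) \<and>
           R_ring A \<simeq> laurent_ring Quot
             (PIdl\<^bsub>laurent_ring\<^esub> (Poly_Mapping.single (int k) 1 + (\<Sum>i<k. Poly_Mapping.single (int i) (c i))))"
proof -
  let ?p = "Polynomial.monom 1 k + (\<Sum>i<k. Polynomial.monom (a i) i)"
  obtain M where M: "Polynomial.monom 1 l * ?p = of_int_poly M"
    and min: "\<And>h. mat_poly h A = 0\<^sub>m K K \<longleftrightarrow> M dvd h"
    using integral_minimal_poly[OF assms(1,3)] by metis
  define c where "c i = Polynomial.coeff M (l + i)" for i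
  define p where "p = Polynomial.monom 1 k + (\<Sum>i<k. Polynomial.monom (c i) i)"
  have a: "a i = of_int (c i)" if "i < k" for i
  proof -
    have "of_int (c i) = Polynomial.coeff (Polynomial.monom 1 l * ?p) (l + i)"
      by (simp add: M c_def)
    also have "\<dots> = a i" using that by (simp add: coeff_monom_mult coeff_sum)
    finally show ?thesis by simp
  qed
  have "of_int_poly p = ?p" by (simp add: p_def hom_distribs a)
  then have "of_int_poly M = (of_int_poly (Polynomial.monom 1 l * p) :: rat poly)"
    by (simp add: hom_distribs flip: M)
  then have Mp: "M = Polynomial.monom 1 l * p" by simp
  have "Polynomial.coeff p 0 \<noteq> 0"
    using assms(4) a[of 0] by (cases "k = 0") (auto simp: p_def coeff_sum)
  then have "R_ring A \<simeq> laurent_ring Quot (PIdl\<^bsub>laurent_ring\<^esub> (laurent_of_poly p))"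
    using min by (intro R_ring_iso_laurent_quotient[OF assms(1)]) (auto simp: Mp)
  then show ?thesis using a
    by (intro exI[of _ c]) (simp add: p_def laurent_of_poly_add laurent_of_poly_sum laurent_of_poly_monom)
qed

end
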